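(* Let $\mathcal{V}$ be a semi-inner product space over $\mathbb{F}\in\{\mathbb{R},\mathbb{C}\}$ and let $M=M^*\in\mathbb{F}^{2\times 2}$. Let $G\in\mathscr{R}(\mathcal{V})$ be a relation on $\mathcal{V}$ and let $\mathcal{C}_\Phi\subseteq\mathscr{R}(\mathcal{V})$ be a set of relations on $\mathcal{V}$. Consider the following three statements. (i) There exists $N=N^*\in\mathbb{F}^{2\times 2}$ with $M+N\prec 0$ such that $$\left\langle \begin{pmatrix} G\xi\\ \xi\end{pmatrix},\, N\begin{pmatrix} G\xi\\ \xi\end{pmatrix}\right\rangle\ge 0\quad\text{for all }\xi\in\mathrm{dom}(G).$$ (ii) There exists $\gamma>0$ such that for all $u=(u_1,u_2)$, $y=(y_1,y_2)$, $e=(e_1,e_2)$ in $\mathcal{V}^2$: if $$\left\langle \begin{pmatrix} e_2\\ y_2\end{pmatrix},\, M\begin{pmatrix} e_2\\ y_2\end{pmatrix}\right\rangle\ge 0$$ and $e_1=u_1+y_2$, $e_2=u_2+y_1$, and $y_1=Ge_1$ hold, then $\|y\|\le\gamma\|u\|$. (iii) There exists $\gamma>0$ such that for all $\Phi\in\mathcal{C}_\Phi$: if $$\left\langle \begin{pmatrix} \xi\\ \Phi\xi\end{pmatrix},\, M\begin{pmatrix} \xi\\ \Phi\xi\end{pmatrix}\right\rangle\ge 0\quad\text{for all }\xi\in\mathrm{dom}(\Phi),$$ then $\|y\|\le\gamma\|u\|$ for all $(u,y)\in R_{uy}$, where $R_{uy}$ is the closed-loop relation of $G$ and $\Phi$.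 Then (i) $\iff$ (ii), and (ii) $\implies$ (iii).
   Context: $\mathbb{F}$ is the field of real or complex numbers; $X^*$ is the conjugate transpose, and $\prec,\preceq,\succ,\succeq$ denote the (semi)definite partial ordering on $\mathbb{F}^{n\times n}$. A semi-inner product space is a vector space $\mathcal{V}$ over $\mathbb{F}$ with a semi-inner product $\langle\cdot,\cdot\rangle$: it is linear in its second argument, satisfies $\langle x,y\rangle=\overline{\langle y,x\rangle}$, and $\langle x,x\rangle\ge 0$ for all $x$, but $\|x\|:=\sqrt{\langle x,x\rangle}=0$ need not imply $x=0$. A relation on $\mathcal{V}$ is a subset $R\subseteq\mathcal{V}\times\mathcal{V}$; $\mathscr{R}(\mathcal{V})$ is the set of all relations on $\mathcal{V}$. $\mathrm{dom}(R):=\{x\in\mathcal{V} : (x,y)\in R\text{ for some }y\in\mathcal{V}\}$. For $x\in\mathrm{dom}(R)$, $Rx$ denotes any $y\in\mathcal{V}$ with $(x,y)\in R$. Thus an equation $y=Rx$ means $(x,y)\in R$, and a condition involving $\xi$ and $R\xi$ required for all $\xi\in\mathrm{dom}(R)$ is required for every pair $(\xi,\zeta)\in R$, with $\zeta$ in place of $R\xi$. Elements of $\mathcal{V}^2$ are augmented vectors $\begin{pmatrix}\xi_1\\ \xi_2\end{pmatrix}$ with $\xi_1,\xi_2\in\mathcal{V}$. For $N\in\mathbb{F}^{2\times2}$, $N\xi:=\begin{pmatrix}N_{11}\xi_1+N_{12}\xi_2\\ N_{21}\xi_1+N_{22}\xi_2\end{pmatrix}\in\mathcal{V}^2$. On $\mathcal{V}^2$,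 $\langle\xi,\zeta\rangle:=\langle\xi_1,\zeta_1\rangle+\langle\xi_2,\zeta_2\rangle$ and $\|\xi\|:=\sqrt{\langle\xi,\xi\rangle}$. For relations $G,\Phi$ on $\mathcal{V}$, the feedback interconnection equations are $e_1=u_1+y_2$, $y_2=\Phi e_2$, $e_2=u_2+y_1$, $y_1=Ge_1$. The closed-loop relation is $R_{uy}:=\{(u,y)\in\mathcal{V}^2\times\mathcal{V}^2 : \text{these four equations hold for some } e\in\mathcal{V}^2\}$. *)

theory Defs
  imports "HOL-Analysis.Analysis" "Jordan_Normal_Form.Conjugate"
begin

text \<open>
  The scalar field is the real or the complex numbers. The class below has both as instances, and
  \<open>real_or_complex_cases\<close> shows that its axioms admit nothing else up to isomorphism. The order is
  that of \<open>HOL-Library.Complex_Order\<close>: \<open>0 \<le> z\<close> means that \<open>z\<close> is real and nonnegative.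
\<close>

class real_or_complex = real_normed_field + conjugatable_ordered_field +
  assumes mult_conjugate_self: "z * conjugate z = scaleR ((norm z)\<^sup>2) 1"
    and add_conjugate_self: "\<exists>r. z + conjugate z = scaleR r 1"
    and nonneg_iff_scaleR: "0 \<le> z \<longleftrightarrow> (\<exists>r\<ge>0. z = scaleR r 1)"

instance real :: real_or_complex
  by intro_classes (auto simp: power2_eq_square)

instance complex :: real_or_complex
proof
  fix z :: complex
  show "z * conjugate z = scaleR ((norm z)\<^sup>2) 1"
    using complex_norm_square[of z] by (simp add: scaleR_conv_of_real)
  show "\<exists>r. z + conjugate z = scaleR r 1"
    by (rule exI[of _ "2 * Re z"]) (simp add: complex_eq_iff)
  show "0 \<le> z \<longleftrightarrow> (\<exists>r\<ge>0. z = scaleR r 1)"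
    by (auto simp: less_eq_complex_def complex_eq_iff)
qed

lemma real_or_complex_cases:
  "(\<forall>z::'a::real_or_complex. z \<in> \<real> \<and> conjugate z = z) \<or>
   (\<exists>i::'a. i * i = - 1 \<and> conjugate i = - i \<and> (\<forall>z. \<exists>a b. z = of_real a + of_real b * i))"
proof -
  have fixed_real: "z \<in> \<real>" if fz: "conjugate z = z" for z :: 'a
  proof -
    obtain r where "z + z = scaleR r 1"
      using add_conjugate_self[of z] unfolding fz by blast
    then have "z = of_real (r / 2)"
      by (simp add: scaleR_conv_of_real eq_divide_eq mult.commute)
    then show ?thesis by (metis Reals_of_real)
  qed
  show ?thesis
  proof (cases "\<forall>z::'a. conjugate z = z")
    case True
    with fixed_real show ?thesis by blast
  next
    case False
    have diff: "conjugate (x - y) = conjugate x - conjugate y" for x y :: 'a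
      using conjugate_dist_add[of x "- y"] conjugate_neg[of y] by simp
    from False obtain w :: 'a where w: "conjugate w \<noteq> w" by blast
    define s where "s = w - conjugate w"
    have s: "s \<noteq> 0" "conjugate s = - s"
      using w by (auto simp: s_def diff)
    have ss: "s * s = - of_real ((norm s)\<^sup>2)"
      using mult_conjugate_self[of s] s
      by (simp add: scaleR_conv_of_real neg_eq_iff_add_eq_0 eq_neg_iff_add_eq_0 add.commute)
    have re: "conjugate (of_real a :: 'a) = of_real a" for a
    proof (cases "a = 0")
      case False
      have "of_real a * conjugate (of_real a :: 'a) = of_real a * of_real a"
        using mult_conjugate_self[of "of_real a :: 'a"]
        by (simp add: scaleR_conv_of_real power2_eq_square)
      with False show ?thesis by simp
    qed simp
    define i where "i = of_real (1 / norm s) * s"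
    have i: "conjugate i = - i"
      by (simp only: i_def conjugate_dist_mul re s) simp
    have "i * i = of_real (1 / norm s) * of_real (1 / norm s) * (s * s)"
      by (simp add: i_def)
    also have "\<dots> = - 1"
      using s(1) by (simp add: ss power2_eq_square)
    finally have ii: "i * i = - 1" .
    have "\<exists>a b. z = of_real a + of_real b * i" for z :: 'a
    proof -
      define p where "p = z + conjugate z"
      define q where "q = (conjugate z - z) * i"
      have "conjugate p = p"
        by (simp add: p_def conjugate_dist_add add.commute)
      then obtain a where a: "p = of_real a"
        using fixed_real Reals_cases by metis
      have "conjugate q = q"
        by (simp add: q_def conjugate_dist_mul diff i algebra_simps)
      then obtain b where b: "q = of_real b"
        using fixed_real Reals_cases by metis
      have "q * i = z - conjugate z"
        using ii by (simp add: q_def mult.assoc)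
      then have "z + z = of_real a + of_real b * i"
        unfolding a[symmetric] b[symmetric] by (simp add: p_def)
      then have "z = of_real (a / 2) + of_real (b / 2) * i"
        by (simp add: field_simps)
      then show ?thesis by blast
    qed
    with ii i show ?thesis by blast
  qed
qed

definition conj_transpose :: "'f::conjugate^'n^'m \<Rightarrow> 'f^'m^'n" where
  "conj_transpose A = (\<chi> i j. conjugate (A $ j $ i))"

definition hermitian :: "'f::conjugate^'n^'n \<Rightarrow> bool" where
  "hermitian A \<longleftrightarrow> conj_transpose A = A"

definition pos_definite :: "'f::real_or_complex^'n^'n \<Rightarrow> bool" where
  "pos_definite A \<longleftrightarrow>
     hermitian A \<and> (\<forall>x. x \<noteq> 0 \<longrightarrow> 0 < (\<Sum>i\<in>UNIV. conjugate (x $ i) * (A *v x) $ i))"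

definition definite_less :: "'f::real_or_complex^'n^'n \<Rightarrow> 'f^'n^'n \<Rightarrow> bool" (infix "\<prec>" 50) where
  "A \<prec> B \<longleftrightarrow> pos_definite (B - A)"

locale semi_inner_product_space = vector_space scl
  for scl :: "'f::real_or_complex \<Rightarrow> 'v::ab_group_add \<Rightarrow> 'v" +
  fixes ip :: "'v \<Rightarrow> 'v \<Rightarrow> 'f"
  assumes ip_add_right: "ip x (y + z) = ip x y + ip x z"
    and ip_scale_right: "ip x (scl c y) = c * ip x y"
    and ip_conjugate: "ip x y = conjugate (ip y x)"
    and ip_self_nonneg: "0 \<le> ip x x"

definition mat_app :: "('f \<Rightarrow> 'v::plus \<Rightarrow> 'v) \<Rightarrow> 'f^2^2 \<Rightarrow> 'v \<times> 'v \<Rightarrow> 'v \<times> 'v" where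
  "mat_app scl N \<xi> =
     (scl (N $ 1 $ 1) (fst \<xi>) + scl (N $ 1 $ 2) (snd \<xi>),
      scl (N $ 2 $ 1) (fst \<xi>) + scl (N $ 2 $ 2) (snd \<xi>))"

definition ip2 :: "('v \<Rightarrow> 'v \<Rightarrow> 'f::plus) \<Rightarrow> 'v \<times> 'v \<Rightarrow> 'v \<times> 'v \<Rightarrow> 'f" where
  "ip2 ip \<xi> \<zeta> = ip (fst \<xi>) (fst \<zeta>) + ip (snd \<xi>) (snd \<zeta>)"

text \<open>
  The inner product of a vector with itself is a nonnegative real element of the scalar field;
  the inner \<open>norm\<close> (absolute value of scalars) only serves to read it as a value of type \<open>real\<close>.
\<close>

definition norm2 :: "('v \<Rightarrow> 'v \<Rightarrow> 'f::real_normed_field) \<Rightarrow> 'v \<times> 'v \<Rightarrow> real" where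
  "norm2 ip \<xi> = sqrt (norm (ip2 ip \<xi> \<xi>))"

definition closed_loop ::
    "('v::plus \<times> 'v) set \<Rightarrow> ('v \<times> 'v) set \<Rightarrow> (('v \<times> 'v) \<times> ('v \<times> 'v)) set" where
  "closed_loop G \<Phi> =
     {((u1, u2), (y1, y2)) | u1 u2 y1 y2.
        \<exists>e1 e2. e1 = u1 + y2 \<and> (e2, y2) \<in> \<Phi> \<and> e2 = u2 + y1 \<and> (e1, y1) \<in> G}"

end

theory Submission
  imports Defs
begin

text \<open>
  Write \<open>n x\<close> for the squared norm and \<open>q x\<close> for the quadratic form of \<open>M\<close> on augmented vectors.
  Two observations turn the theorem into a statement about these two real functions.

  \<^item> Statement (i) says that \<open>q x \<le> - \<epsilon> * n x\<close> for some \<open>\<epsilon> > 0\<close> and all \<open>x\<close> in the inverse graph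
    of \<open>G\<close>: if \<open>N\<close> is a multiplier, then \<open>- (M + N)\<close> is positive definite and so exceeds some
    \<open>\<epsilon> * n\<close>; conversely \<open>N = - M - \<epsilon> I\<close> is a multiplier (\<open>multiplier_iff_strictly_negative\<close>).

  \<^item> With \<open>x = (y1, e1)\<close> and \<open>z = (e2, y2)\<close> the loop equations say \<open>z - x = (u2, - u1)\<close>. Statement
    (ii) therefore bounds \<open>n x\<close> by a multiple of \<open>n (z - x)\<close> whenever \<open>x\<close> lies in the inverse graph
    and \<open>q z \<ge> 0\<close>: the inverse graph keeps a positive angular distance from the cone
    \<open>q \<ge> 0\<close> (\<open>gain_iff_strictly_negative\<close>).

  So it remains to compare strict negativity of \<open>q\<close> at \<open>x\<close> with the distance of \<open>x\<close> from the cone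
  \<open>q \<ge> 0\<close>, uniformly in \<open>x\<close>. That strict negativity forces a distance is the boundedness of \<open>q\<close>
  (\<open>negative_far_from_nonneg\<close>). For the other direction a point with \<open>q x > - \<epsilon> * n x\<close>
  has to be moved into the cone by a short step (\<open>nonneg_close_or_negative\<close>). The step is taken
  in the direction of the gradient, \<open>z = x + t M x\<close>. By the Cayley-Hamilton theorem \<open>M\<close> acts as an
  operator with \<open>M\<^sup>2 = \<tau> M - \<delta> I\<close>, where the trace \<open>\<tau>\<close> and the determinant \<open>\<delta>\<close> are real, so
  \<open>n (M x)\<close>, \<open>q z\<close> and \<open>n (z - x)\<close> are all linear combinations of \<open>q x\<close> and \<open>n x\<close>. The signs of \<open>\<tau>\<close> and \<open>\<delta>\<close> tell which
  step size works, so that \<open>M\<close> need not be diagonalised.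

  Statement (iii) follows from (ii) because a pair of the relation \<open>\<Phi>\<close> that closes the loop
  satisfies the premise of (ii).
\<close>

section \<open>Real parts of scalars\<close>

text \<open>
  The scalars are abstract, and their real part is recovered from the axiom that
  \<open>z + conjugate z\<close> is real.
\<close>

definition real_part :: "'f::real_or_complex \<Rightarrow> real" where
  "real_part z = (THE r. z + conjugate z = of_real (2 * r))"

lemma real_part: "z + conjugate z = of_real (2 * real_part z)"
  for z :: "'f::real_or_complex"
proof -
  obtain r where r: "z + conjugate z = scaleR r 1"
    using add_conjugate_self by blast
  have "\<exists>!r. z + conjugate z = of_real (2 * r)"
  proof (rule ex1I)
    show "z + conjugate z = of_real (2 * (r / 2))"
      using r by (simp add: scaleR_conv_of_real)
    show "r' = r / 2" if "z + conjugate z = of_real (2 * r')" for r'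
    proof -
      have "(of_real (2 * r') :: 'f) = of_real r"
        using that r by (simp add: scaleR_conv_of_real)
      then show ?thesis by (simp only: of_real_eq_iff)
    qed
  qed
  then show ?thesis unfolding real_part_def by (rule theI')
qed

lemma conjugate_of_real [simp]: "conjugate (of_real a :: 'f::real_or_complex) = of_real a"
proof (cases "a = 0")
  case False
  have "of_real a * conjugate (of_real a :: 'f) = of_real a * of_real a"
    using mult_conjugate_self[of "of_real a :: 'f"]
    by (simp add: scaleR_conv_of_real power2_eq_square)
  with False show ?thesis by simp
qed simp

lemma conjugate_diff: "conjugate (x - y) = conjugate x - conjugate y"
  for x y :: "'f::real_or_complex"
  using conjugate_dist_add[of x "- y"] conjugate_neg[of y] by simp

lemma conjugate_one [simp]: "conjugate (1 :: 'f::real_or_complex) = 1"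
  using conjugate_of_real[of 1, where 'f = 'f] by simp

lemma real_part_eqI: "z + conjugate z = of_real (2 * r) \<Longrightarrow> real_part z = r"
  for z :: "'f::real_or_complex"
  using real_part[of z] by (metis of_real_eq_iff mult_cancel_left zero_neq_numeral)

lemma real_part_add: "real_part (x + y) = real_part x + real_part y"
  for x y :: "'f::real_or_complex"
proof (rule real_part_eqI)
  have "x + y + conjugate (x + y) = (x + conjugate x) + (y + conjugate y)"
    by (simp add: conjugate_dist_add)
  then show "x + y + conjugate (x + y) = of_real (2 * (real_part x + real_part y))"
    by (simp add: real_part distrib_left)
qed

lemma real_part_of_real_mult: "real_part (of_real r * z) = r * real_part z"
  for z :: "'f::real_or_complex"
proof (rule real_part_eqI)
  have "of_real r * z + conjugate (of_real r * z) = of_real r * (z + conjugate z)"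
    by (simp add: conjugate_dist_mul distrib_left)
  then show "of_real r * z + conjugate (of_real r * z) = of_real (2 * (r * real_part z))"
    by (simp add: real_part)
qed

lemma real_part_of_real [simp]: "real_part (of_real r :: 'f::real_or_complex) = r"
  by (rule real_part_eqI) simp

lemma real_part_conjugate: "real_part (conjugate z) = real_part z"
  for z :: "'f::real_or_complex"
  by (rule real_part_eqI) (use real_part[of z] in \<open>simp only: conjugate_id add.commute\<close>)

lemma of_real_real_part: "conjugate z = z \<Longrightarrow> of_real (real_part z) = z"
  for z :: "'f::real_or_complex"
  using real_part[of z] by simp

lemma of_real_nonneg_iff [simp]: "0 \<le> (of_real r :: 'f::real_or_complex) \<longleftrightarrow> 0 \<le> r"
  using nonneg_iff_scaleR[of "of_real r :: 'f"] by (auto simp: scaleR_conv_of_real)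

lemma of_real_pos_iff [simp]: "0 < (of_real r :: 'f::real_or_complex) \<longleftrightarrow> 0 < r"
  by (metis less_le of_real_nonneg_iff of_real_eq_0_iff)

lemma nonneg_imp_of_real: "0 \<le> z \<Longrightarrow> of_real (real_part z) = z"
  for z :: "'f::real_or_complex"
  using nonneg_iff_scaleR[of z] by (auto simp: scaleR_conv_of_real)

lemma nonneg_iff_real_part: "conjugate z = z \<Longrightarrow> 0 \<le> z \<longleftrightarrow> 0 \<le> real_part z"
  for z :: "'f::real_or_complex"
  using of_real_nonneg_iff[of "real_part z", where 'f = 'f] by (simp only: of_real_real_part)

section \<open>Augmented vectors as a real semi-inner product space\<close>

lemma hermitian_sym:
  assumes "hermitian M"
  shows "conjugate (M $ i $ j) = M $ j $ i"
proof -
  have "conjugate (M $ i $ j) = conj_transpose M $ j $ i"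
    by (simp add: conj_transpose_def)
  then show ?thesis using assms by (simp add: hermitian_def)
qed

context semi_inner_product_space
begin

lemma ip_add_left: "ip (x + y) z = ip x z + ip y z"
  by (simp only: ip_conjugate[of _ z] ip_add_right conjugate_dist_add)

lemma ip_scale_left: "ip (scl c x) y = conjugate c * ip x y"
  by (simp only: ip_conjugate[of _ y] ip_scale_right conjugate_dist_mul)

lemma ip_minus_right: "ip x (- y) = - ip x y"
  using ip_scale_right[of x "- 1" y] by simp

lemma ip_minus_left: "ip (- x) y = - ip x y"
  by (simp only: ip_conjugate[of _ y] ip_minus_right conjugate_neg)

lemma ip_diff_right: "ip x (y - z) = ip x y - ip x z"
  using ip_add_right[of x y "- z"] by (simp add: ip_minus_right)

lemma ip_diff_left: "ip (x - y) z = ip x z - ip y z"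
  using ip_add_left[of x "- y" z] by (simp add: ip_minus_left)

lemmas ip_simps = ip_add_left ip_scale_left ip_minus_left ip_diff_left
  ip_add_right ip_scale_right ip_minus_right ip_diff_right

definition real_scale2 :: "real \<Rightarrow> 'v \<times> 'v \<Rightarrow> 'v \<times> 'v" where
  "real_scale2 r \<xi> = (scl (of_real r) (fst \<xi>), scl (of_real r) (snd \<xi>))"

definition real_ip2 :: "'v \<times> 'v \<Rightarrow> 'v \<times> 'v \<Rightarrow> real" where
  "real_ip2 \<xi> \<zeta> = real_part (ip2 ip \<xi> \<zeta>)"

lemma ip2_conjugate: "conjugate (ip2 ip \<xi> \<zeta>) = ip2 ip \<zeta> \<xi>"
  unfolding ip2_def conjugate_dist_add by (simp flip: ip_conjugate)

text \<open>
  All quantities that are compared below are real, so the pairs are treated as a space over the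
  reals, with the real part of their inner product.
\<close>

lemma real_semi_inner_product_space: "semi_inner_product_space real_scale2 real_ip2"
proof
  fix x y z :: "'v \<times> 'v" and a b :: real
  show "real_scale2 a (x + y) = real_scale2 a x + real_scale2 a y"
    by (simp add: real_scale2_def scale_right_distrib)
  show "real_scale2 (a + b) x = real_scale2 a x + real_scale2 b x"
    by (simp add: real_scale2_def scale_left_distrib)
  show "real_scale2 a (real_scale2 b x) = real_scale2 (a * b) x"
    by (simp add: real_scale2_def)
  show "real_scale2 1 x = x"
    by (simp add: real_scale2_def)
  show "real_ip2 x (y + z) = real_ip2 x y + real_ip2 x z"
    by (simp add: real_ip2_def ip2_def ip_simps real_part_add)
  show "real_ip2 x (real_scale2 a y) = a * real_ip2 x y"
    by (simp add: real_ip2_def ip2_def real_scale2_def ip_simps real_part_add real_part_of_real_mult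
        distrib_left)
  show "real_ip2 x y = conjugate (real_ip2 y x)"
    unfolding real_ip2_def ip2_conjugate[of y x, symmetric] real_part_conjugate by simp
  show "0 \<le> real_ip2 x x"
  proof -
    have "0 \<le> ip2 ip x x"
      unfolding ip2_def by (intro add_nonneg_nonneg ip_self_nonneg)
    then have "0 \<le> (of_real (real_ip2 x x) :: 'f)"
      unfolding real_ip2_def by (simp only: nonneg_imp_of_real)
    then show ?thesis by simp
  qed
qed

lemma norm2_eq: "norm2 ip \<xi> = sqrt (real_ip2 \<xi> \<xi>)"
proof -
  interpret R: semi_inner_product_space real_scale2 real_ip2
    by (rule real_semi_inner_product_space)
  have "ip2 ip \<xi> \<xi> = of_real (real_ip2 \<xi> \<xi>)"
    unfolding real_ip2_def by (simp add: of_real_real_part ip2_conjugate)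
  then show ?thesis
    using R.ip_self_nonneg[of \<xi>] by (simp add: norm2_def)
qed

lemma ip2_mat_app_adjoint:
  assumes "hermitian M"
  shows "ip2 ip \<xi> (mat_app scl M \<zeta>) = ip2 ip (mat_app scl M \<xi>) \<zeta>"
  by (simp add: ip2_def mat_app_def ip_simps hermitian_sym[OF assms] algebra_simps)

text \<open>
  The value of a hermitian form is a real scalar, so that no information is lost in its real part.
\<close>

lemma nonneg_form_iff:
  assumes "hermitian M"
  shows "0 \<le> ip2 ip \<xi> (mat_app scl M \<xi>) \<longleftrightarrow> 0 \<le> real_ip2 \<xi> (mat_app scl M \<xi>)"
  unfolding real_ip2_def
  by (rule nonneg_iff_real_part) (simp only: ip2_conjugate ip2_mat_app_adjoint[OF assms])

end

section \<open>Self-adjoint operators with a quadratic minimal equation\<close>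

text \<open>
  The equation \<open>T\<^sup>2 = \<tau> T - \<delta>\<close> is required only up to vectors of seminorm zero, as seen by the inner
  product. Self-adjointness makes \<open>T\<close> additive and homogeneous in the same sense.
\<close>

locale quadratic_self_adjoint = semi_inner_product_space scl ip
  for scl :: "real \<Rightarrow> 'v::ab_group_add \<Rightarrow> 'v" and ip +
  fixes T :: "'v \<Rightarrow> 'v" and \<tau> \<delta> :: real
  assumes self_adjoint: "ip x (T y) = ip (T x) y"
    and quadratic: "ip x (T (T y)) = \<tau> * ip x (T y) - \<delta> * ip x y"
begin

lemma ip_commute: "ip x y = ip y x"
  using ip_conjugate[of x y] by simp

lemma sqnorm_add_le: "ip (x + y) (x + y) \<le> 2 * ip x x + 2 * ip y y"
  using ip_self_nonneg[of "x - y"] by (simp add: ip_simps ip_commute[of y x])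

text \<open>
  This identity has two uses. It eliminates the norm of \<open>T x\<close> in favour of the form and the norm of
  \<open>x\<close>, and, as its left-hand side is nonnegative, it restricts the form by the signs of \<open>\<tau>\<close> and \<open>\<delta>\<close>.
\<close>

lemma sqnorm_image: "ip (T x) (T x) = \<tau> * ip x (T x) - \<delta> * ip x x"
  by (metis self_adjoint quadratic)

lemma sqnorm_step:
  "ip (x + scl t (T x)) (x + scl t (T x)) = ip x x + 2 * t * ip x (T x) + t\<^sup>2 * ip (T x) (T x)"
  by (simp add: ip_simps ip_commute[of "T x" x] power2_eq_square algebra_simps)

lemma form_add: "ip (x + w) (T (x + w)) = ip x (T x) + 2 * ip (T x) w + ip w (T w)"
proof -
  have "ip (x + w) (T (x + w)) = ip (T (x + w)) x + ip (T (x + w)) w"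
    by (simp only: self_adjoint ip_add_right)
  also have "\<dots> = ip (x + w) (T x) + ip (x + w) (T w)"
    by (simp only: self_adjoint)
  also have "\<dots> = ip x (T x) + ip w (T x) + (ip x (T w) + ip w (T w))"
    by (simp only: ip_add_left)
  also have "ip w (T x) = ip (T x) w" by (rule ip_commute)
  also have "ip x (T w) = ip (T x) w" by (rule self_adjoint)
  finally show ?thesis by simp
qed

lemma young_inequality: "0 < s \<Longrightarrow> 2 * ip x y \<le> s * ip x x + ip y y / s"
  using ip_self_nonneg[of "scl s x - y"]
  by (simp add: ip_simps ip_commute[of y x] field_simps power2_eq_square)

text \<open>
  Positivity of \<open>x + \<eta> T x\<close> and \<open>x - \<eta> T x\<close> bounds the form by the squared norms of \<open>x\<close> and
  \<open>T x\<close>. The latter contains the form again, with the factor \<open>\<tau>\<close>; a small \<open>\<eta>\<close> absorbs that term.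
\<close>

lemma form_bounded: "\<exists>K\<ge>0. \<forall>x. \<bar>ip x (T x)\<bar> \<le> K * ip x x"
proof -
  \<comment> \<open>small enough that the term with \<open>\<eta>\<^sup>2 * \<bar>\<tau>\<bar>\<close> uses up at most half of the left-hand side\<close>
  define \<eta> where "\<eta> = 1 / (\<bar>\<tau>\<bar> + 1)"
  have \<eta>: "0 < \<eta>" "\<eta> * \<bar>\<tau>\<bar> \<le> 1"
    by (auto simp: \<eta>_def field_simps)
  have "\<bar>ip x (T x)\<bar> \<le> ((1 + \<eta>\<^sup>2 * \<bar>\<delta>\<bar>) / \<eta>) * ip x x" for x
  proof -
    have 1: "2 * \<eta> * \<bar>ip x (T x)\<bar> \<le> ip x x + \<eta>\<^sup>2 * ip (T x) (T x)"
      using ip_self_nonneg[of "x + scl \<eta> (T x)"] ip_self_nonneg[of "x + scl (- \<eta>) (T x)"]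
      unfolding sqnorm_step by (simp add: abs_if)
    have "ip (T x) (T x) \<le> \<bar>\<tau>\<bar> * \<bar>ip x (T x)\<bar> + \<bar>\<delta>\<bar> * ip x x"
    proof -
      have "\<tau> * ip x (T x) \<le> \<bar>\<tau>\<bar> * \<bar>ip x (T x)\<bar>"
        by (metis abs_ge_self abs_mult)
      moreover have "- \<delta> * ip x x \<le> \<bar>\<delta>\<bar> * ip x x"
        by (rule mult_right_mono) (use ip_self_nonneg in auto)
      ultimately show ?thesis unfolding sqnorm_image by linarith
    qed
    then have "\<eta>\<^sup>2 * ip (T x) (T x) \<le> \<eta>\<^sup>2 * (\<bar>\<tau>\<bar> * \<bar>ip x (T x)\<bar> + \<bar>\<delta>\<bar> * ip x x)"
      by (rule mult_left_mono) simp
    also have "\<dots> = (\<eta> * \<bar>\<tau>\<bar>) * (\<eta> * \<bar>ip x (T x)\<bar>) + \<eta>\<^sup>2 * \<bar>\<delta>\<bar> * ip x x"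
      by (simp add: power2_eq_square algebra_simps)
    also have "(\<eta> * \<bar>\<tau>\<bar>) * (\<eta> * \<bar>ip x (T x)\<bar>) \<le> 1 * (\<eta> * \<bar>ip x (T x)\<bar>)"
      by (rule mult_right_mono) (use \<eta> in auto)
    finally have "\<eta> * \<bar>ip x (T x)\<bar> \<le> (1 + \<eta>\<^sup>2 * \<bar>\<delta>\<bar>) * ip x x"
      using 1 by (simp add: algebra_simps)
    then show ?thesis using \<eta> by (simp add: field_simps)
  qed
  moreover have "0 \<le> (1 + \<eta>\<^sup>2 * \<bar>\<delta>\<bar>) / \<eta>" using \<eta> by simp
  ultimately show ?thesis by blast
qed

lemma sqnorm_image_bounded: "\<exists>K>0. \<forall>x. ip (T x) (T x) \<le> K * ip x x"
proof -
  obtain K where K: "0 \<le> K" "\<And>x. \<bar>ip x (T x)\<bar> \<le> K * ip x x"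
    using form_bounded by blast
  have "ip (T x) (T x) \<le> (\<bar>\<tau>\<bar> * K + \<bar>\<delta>\<bar> + 1) * ip x x" for x
  proof -
    have "\<tau> * ip x (T x) \<le> \<bar>\<tau>\<bar> * \<bar>ip x (T x)\<bar>"
      by (metis abs_ge_self abs_mult)
    also have "\<dots> \<le> \<bar>\<tau>\<bar> * (K * ip x x)"
      by (rule mult_left_mono) (use K in auto)
    finally have "\<tau> * ip x (T x) \<le> \<bar>\<tau>\<bar> * (K * ip x x)" .
    moreover have "- \<delta> * ip x x \<le> \<bar>\<delta>\<bar> * ip x x"
      by (rule mult_right_mono) (use ip_self_nonneg in auto)
    ultimately show ?thesis
      using ip_self_nonneg[of x] unfolding sqnorm_image by (simp add: algebra_simps)
  qed
  moreover have "0 < \<bar>\<tau>\<bar> * K + \<bar>\<delta>\<bar> + 1"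
    using K(1) by (simp add: add_nonneg_pos)
  ultimately show ?thesis by blast
qed

text \<open>
  A step \<open>w = z - x\<close> changes the form by \<open>2 * ip (T x) w + ip w (T w)\<close>. To climb from
  \<open>- \<epsilon> * ip x x\<close> to zero this change has to be at least \<open>\<epsilon> * ip x x\<close>, while it is
  at most a constant times \<open>\<parallel>x\<parallel> * \<parallel>w\<parallel> + \<parallel>w\<parallel>\<^sup>2\<close>.
\<close>

lemma negative_far_from_nonneg:
  assumes "0 < \<epsilon>"
  shows "\<exists>C>0. \<forall>x z. ip x (T x) \<le> - \<epsilon> * ip x x \<longrightarrow> 0 \<le> ip z (T z) \<longrightarrow>
    ip x x \<le> C * ip (z - x) (z - x)"
proof -
  obtain K where K: "0 \<le> K" "\<And>x. \<bar>ip x (T x)\<bar> \<le> K * ip x x"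
    using form_bounded by blast
  obtain L where L: "0 < L" "\<And>x. ip (T x) (T x) \<le> L * ip x x"
    using sqnorm_image_bounded by blast
  \<comment> \<open>weight that leaves half of \<open>\<epsilon> * ip x x\<close> after the mixed term has been estimated\<close>
  define s where "s = \<epsilon> / (2 * L)"
  have s: "0 < s" "s * L = \<epsilon> / 2" using assms L(1) by (simp_all add: s_def)
  have "ip x x \<le> (2 / \<epsilon> * (1 / s + K)) * ip (z - x) (z - x)"
    if x: "ip x (T x) \<le> - \<epsilon> * ip x x" and z: "0 \<le> ip z (T z)" for x z
  proof -
    define w where "w = z - x"
    have "s * ip (T x) (T x) \<le> s * (L * ip x x)"
      by (rule mult_left_mono) (use L s in auto)
    also have "\<dots> = \<epsilon> / 2 * ip x x" using s(2) by (simp add: mult.assoc[symmetric])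
    finally have "2 * ip (T x) w \<le> \<epsilon> / 2 * ip x x + ip w w / s"
      using young_inequality[OF s(1), of "T x" w] by linarith
    moreover have "ip w (T w) \<le> K * ip w w" using K(2)[of w] by linarith
    moreover have "0 \<le> ip x (T x) + 2 * ip (T x) w + ip w (T w)"
      using z form_add[of x w] by (simp add: w_def)
    ultimately have "\<epsilon> / 2 * ip x x \<le> (1 / s + K) * ip w w"
      using x by (simp add: algebra_simps)
    then show ?thesis using assms by (simp add: w_def field_simps)
  qed
  moreover have "0 < 2 / \<epsilon> * (1 / s + K)"
    using assms s(1) K(1) by (intro mult_pos_pos add_pos_nonneg) auto
  ultimately show ?thesis by blast
qed

lemma form_step:
  "ip (x + scl t (T x)) (T (x + scl t (T x))) =
    (1 + 2 * t * \<tau> + t\<^sup>2 * (\<tau>\<^sup>2 - \<delta>)) * ip x (T x) - t * \<delta> * (2 + t * \<tau>) * ip x x"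
proof -
  have "ip (scl t (T x)) (T (scl t (T x))) = ip (T (scl t (T x))) (scl t (T x))"
    by (rule self_adjoint)
  also have "\<dots> = t * ip (scl t (T x)) (T (T x))"
    by (simp only: ip_scale_right self_adjoint)
  also have "\<dots> = t * (t * ip (T x) (T (T x)))"
    by (simp add: ip_scale_left)
  also have "\<dots> = t\<^sup>2 * (\<tau> * ip (T x) (T x) - \<delta> * ip x (T x))"
    by (simp add: quadratic ip_commute[of "T x" x] power2_eq_square)
  finally show ?thesis
    unfolding form_add ip_scale_right sqnorm_image
    by (simp add: power2_eq_square algebra_simps)
qed

text \<open>
  A point where the form is nonnegative is its own witness, so only points with a negative form
  matter. The eigenvalues of \<open>T\<close> are among the roots of \<open>\<lambda>\<^sup>2 - \<tau> \<lambda> + \<delta>\<close>, which explains the cases. For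
  \<open>\<tau>, \<delta> \<ge> 0\<close> no eigenvalue is negative and there are no such points. For \<open>\<tau> < 0 < \<delta>\<close> the form is
  strictly negative everywhere. For \<open>\<delta> = 0\<close> and \<open>\<tau> < 0\<close> the step \<open>- T x / \<tau>\<close> projects \<open>x\<close> onto the
  kernel, and its squared length is proportional to the form. For \<open>\<delta> < 0\<close> the roots have opposite
  signs, and a short step along \<open>T x\<close> turns the form into \<open>A * ip x (T x) + B * ip x x\<close> with
  \<open>A, B > 0\<close>, which is negative only at points with \<open>ip x (T x) < - (B / A) * ip x x\<close>.
\<close>

lemma nonneg_close_or_negative:
  assumes c: "0 < c"
  shows "\<exists>\<epsilon>>0. \<forall>x. ip x (T x) \<le> - \<epsilon> * ip x x \<or>
    (\<exists>z. 0 \<le> ip z (T z) \<and> ip (z - x) (z - x) \<le> c * ip x x)"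
    (is "\<exists>\<epsilon>>0. \<forall>x. ?P \<epsilon> x")
proof -
  have step: "ip (x + scl t (T x) - x) (x + scl t (T x) - x) = t\<^sup>2 * ip (T x) (T x)" for x t
    by (simp add: ip_simps power2_eq_square)
  have close_self: "?P \<epsilon> x" if "0 \<le> ip x (T x)" for x \<epsilon>
  proof (intro disjI2 exI conjI)
    show "0 \<le> ip x (T x)" by fact
    show "ip (x - x) (x - x) \<le> c * ip x x"
      using c ip_self_nonneg[of x] step[of x 0] by simp
  qed
  consider (indef) "\<delta> < 0" | (semidef) "0 \<le> \<delta>" "0 \<le> \<tau>" | (neg) "0 < \<delta>" "\<tau> < 0"
    | (degen) "\<delta> = 0" "\<tau> < 0" by linarith
  then show ?thesis
  proof cases
    case semidef
    have "0 \<le> ip x (T x)" for x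
    proof (rule ccontr)
      assume q: "\<not> 0 \<le> ip x (T x)"
      have "\<tau> * ip x (T x) \<le> 0" "0 \<le> \<delta> * ip x x"
        using semidef q ip_self_nonneg[of x] by (auto simp: mult_nonneg_nonpos)
      then have m: "ip (T x) (T x) = 0"
        using ip_self_nonneg[of "T x"] sqnorm_image[of x] by linarith
      \<comment> \<open>as \<open>T x\<close> has seminorm zero, the squared norm of \<open>x + t T x\<close> is affine in \<open>t\<close>;
          this \<open>t\<close> makes it \<open>- 1\<close>\<close>
      define t where "t = - (ip x x + 1) / (2 * ip x (T x))"
      have "2 * t * ip x (T x) = - (ip x x + 1)"
        using q by (simp add: t_def)
      then show False
        using ip_self_nonneg[of "x + scl t (T x)"] unfolding sqnorm_step m by simp
    qed
    then show ?thesis using close_self zero_less_one by blast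
  next
    case neg
    have "ip x (T x) \<le> - (\<delta> / - \<tau>) * ip x x" for x
      using ip_self_nonneg[of "T x"] neg unfolding sqnorm_image by (simp add: field_simps)
    moreover have "0 < \<delta> / - \<tau>" using neg by (simp add: divide_pos_neg)
    ultimately show ?thesis by blast
  next
    case degen
    have "?P (c * - \<tau>) x" for x
    proof (subst disj_commute, rule disjCI)
      define z where "z = x + scl (- 1 / \<tau>) (T x)"
      assume "\<not> ip x (T x) \<le> - (c * - \<tau>) * ip x x"
      then have "\<tau> * ip x (T x) \<le> \<tau> * (- (c * - \<tau>) * ip x x)"
        using degen by (intro mult_left_mono_neg) auto
      then have "(- 1 / \<tau>)\<^sup>2 * ip (T x) (T x) \<le> c * ip x x"
        using degen unfolding sqnorm_image by (simp add: field_simps power2_eq_square)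
      moreover have "ip z (T z) = 0"
        unfolding z_def form_step using degen by (simp add: field_simps power2_eq_square)
      ultimately show "\<exists>z. 0 \<le> ip z (T z) \<and> ip (z - x) (z - x) \<le> c * ip x x"
        unfolding step[of x "- 1 / \<tau>", folded z_def, symmetric] by (intro exI[of _ z]) simp
    qed
    moreover have "0 < c * - \<tau>" using c degen by (simp add: mult_pos_neg)
    ultimately show ?thesis by blast
  next
    case indef
    \<comment> \<open>\<open>A\<close> and \<open>B\<close> are the coefficients of \<open>ip x (T x)\<close> and \<open>ip x x\<close> in the form after the step,
        and \<open>t\<close> is so small that both are positive and the step is short. As \<open>\<epsilon> \<le> 1\<close>, \<open>K\<close> bounds
        the ratio of the squared norms of \<open>T x\<close> and \<open>x\<close> where \<open>- \<epsilon> * ip x x < ip x (T x) < 0\<close>\<close>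
    define K where "K = \<bar>\<tau>\<bar> + \<bar>\<delta>\<bar> + 1"
    define t where "t = min (1 / (4 * K)) (c / K)"
    define A where "A = 1 + 2 * t * \<tau> + t\<^sup>2 * (\<tau>\<^sup>2 - \<delta>)"
    define B where "B = - t * \<delta> * (2 + t * \<tau>)"
    define \<epsilon> where "\<epsilon> = min 1 (B / A)"
    have K: "1 \<le> K" "\<bar>\<tau>\<bar> \<le> K" by (auto simp: K_def)
    have t: "0 < t" using K c by (simp add: t_def)
    have tK: "t * K \<le> 1 / 4" "t * K \<le> c"
    proof -
      have "t * K \<le> 1 / (4 * K) * K" "t * K \<le> c / K * K"
        by (rule mult_right_mono; use K in \<open>simp add: t_def\<close>)+
      then show "t * K \<le> 1 / 4" "t * K \<le> c" using K by auto
    qed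
    have "\<bar>t * \<tau>\<bar> \<le> t * K" using t K by (simp add: abs_mult)
    then have t\<tau>: "- (1 / 4) \<le> t * \<tau>" using tK by linarith
    have "0 \<le> t\<^sup>2 * (\<tau>\<^sup>2 - \<delta>)"
      using indef by (intro mult_nonneg_nonneg) (auto intro: order_trans[of _ 0])
    then have A: "0 < A" using t\<tau> by (simp add: A_def)
    have B: "0 < B" unfolding B_def
      using mult_pos_neg[OF t indef] t\<tau> by (intro mult_pos_pos[of "- t * \<delta>" "2 + t * \<tau>"]) auto
    have \<epsilon>: "0 < \<epsilon>" "\<epsilon> \<le> 1" "\<epsilon> * A \<le> B"
    proof -
      show "0 < \<epsilon>" "\<epsilon> \<le> 1" using A B by (simp_all add: \<epsilon>_def)
      have "\<epsilon> \<le> B / A" by (simp add: \<epsilon>_def)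
      then show "\<epsilon> * A \<le> B" using A by (simp add: pos_le_divide_eq)
    qed
    have "?P \<epsilon> x" for x
    proof (cases "0 \<le> ip x (T x)")
      case True
      then show ?thesis by (rule close_self)
    next
      case False
      show ?thesis
      proof (subst disj_commute, rule disjCI)
        define z where "z = x + scl t (T x)"
        assume "\<not> ip x (T x) \<le> - \<epsilon> * ip x x"
        then have q: "- \<epsilon> * ip x x \<le> ip x (T x)" by simp
        have n: "0 \<le> ip x x" by (rule ip_self_nonneg)
        have "A * (- \<epsilon> * ip x x) \<le> A * ip x (T x)"
          using q A by (intro mult_left_mono) auto
        moreover have "\<epsilon> * A * ip x x \<le> B * ip x x"
          using \<epsilon>(3) n by (rule mult_right_mono)
        moreover have "ip z (T z) = A * ip x (T x) + B * ip x x"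
          unfolding z_def form_step by (simp add: A_def B_def)
        ultimately have qz: "0 \<le> ip z (T z)" by (simp add: mult.assoc mult.left_commute)
        have "\<bar>ip x (T x)\<bar> \<le> \<epsilon> * ip x x" using q False by simp
        also have "\<dots> \<le> 1 * ip x x" using \<epsilon>(2) n by (rule mult_right_mono)
        finally have "\<bar>\<tau>\<bar> * \<bar>ip x (T x)\<bar> \<le> \<bar>\<tau>\<bar> * ip x x"
          by (intro mult_left_mono) auto
        moreover have "\<tau> * ip x (T x) \<le> \<bar>\<tau>\<bar> * \<bar>ip x (T x)\<bar>"
          by (metis abs_ge_self abs_mult)
        ultimately have "ip (T x) (T x) \<le> K * ip x x"
          using indef n unfolding sqnorm_image K_def by (simp add: algebra_simps)
        then have "t\<^sup>2 * ip (T x) (T x) \<le> t\<^sup>2 * (K * ip x x)"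
          by (rule mult_left_mono) simp
        also have "\<dots> = t * (t * K) * ip x x" by (simp add: power2_eq_square)
        also have "\<dots> \<le> 1 * c * ip x x"
        proof (intro mult_right_mono mult_mono)
          have "t * 1 \<le> t * K" using t K by (intro mult_left_mono) auto
          then show "t \<le> 1" using tK by linarith
        qed (use t K tK n c in auto)
        finally have "ip (z - x) (z - x) \<le> c * ip x x"
          by (simp only: z_def step)
        with qz show "\<exists>z. 0 \<le> ip z (T z) \<and> ip (z - x) (z - x) \<le> c * ip x x" by blast
      qed
    qed
    with \<epsilon>(1) show ?thesis by blast
  qed
qed

end

section \<open>Hermitian matrices of order two\<close>

definition real_trace :: "'f::real_or_complex^2^2 \<Rightarrow> real" where
  "real_trace M = real_part (M $ 1 $ 1 + M $ 2 $ 2)"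

definition real_det :: "'f::real_or_complex^2^2 \<Rightarrow> real" where
  "real_det M = real_part (M $ 1 $ 1 * M $ 2 $ 2 - M $ 1 $ 2 * M $ 2 $ 1)"

lemma of_real_real_trace:
  "hermitian M \<Longrightarrow> of_real (real_trace M) = M $ 1 $ 1 + M $ 2 $ 2"
  unfolding real_trace_def
  by (rule of_real_real_part) (simp add: conjugate_dist_add hermitian_sym)

lemma of_real_real_det:
  "hermitian M \<Longrightarrow> of_real (real_det M) = M $ 1 $ 1 * M $ 2 $ 2 - M $ 1 $ 2 * M $ 2 $ 1"
  unfolding real_det_def
  by (rule of_real_real_part) (simp add: conjugate_diff conjugate_dist_mul hermitian_sym mult.commute)

context semi_inner_product_space
begin

lemma mat_app_Cayley_Hamilton:
  assumes "hermitian M"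
  shows "mat_app scl M (mat_app scl M \<xi>) =
    real_scale2 (real_trace M) (mat_app scl M \<xi>) - real_scale2 (real_det M) \<xi>"
  unfolding real_scale2_def mat_app_def of_real_real_trace[OF assms] of_real_real_det[OF assms]
  by (simp add: scale_right_distrib scale_left_distrib scale_left_diff_distrib
      algebra_simps)

lemma quadratic_self_adjoint_mat_app:
  assumes "hermitian M"
  shows "quadratic_self_adjoint real_scale2 real_ip2 (mat_app scl M) (real_trace M) (real_det M)"
proof -
  interpret R: semi_inner_product_space real_scale2 real_ip2
    by (rule real_semi_inner_product_space)
  show ?thesis
  proof
    show "real_ip2 x (mat_app scl M y) = real_ip2 (mat_app scl M x) y" for x y
      by (simp add: real_ip2_def ip2_mat_app_adjoint[OF assms])
    show "real_ip2 x (mat_app scl M (mat_app scl M y)) =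
      real_trace M * real_ip2 x (mat_app scl M y) - real_det M * real_ip2 x y" for x y
      unfolding mat_app_Cayley_Hamilton[OF assms] R.ip_simps by simp
  qed
qed

text \<open>
  Positive definiteness is tested on pairs of scalars, whereas the conclusion is about pairs of
  vectors. The trace \<open>\<tau>\<close> and the determinant \<open>\<delta>\<close> mediate between the two: both are positive, and
  then \<open>sqnorm_image\<close> bounds the form below by \<open>\<delta> / \<tau>\<close> times the squared norm.
\<close>

lemma pos_definite_coercive:
  assumes P: "pos_definite (P :: 'f^2^2)"
  shows "\<exists>\<epsilon>>0. \<forall>\<xi>. \<epsilon> * real_ip2 \<xi> \<xi> \<le> real_ip2 \<xi> (mat_app scl P \<xi>)"
proof -
  have h: "hermitian P" using P by (simp add: pos_definite_def)
  interpret Q: quadratic_self_adjoint real_scale2 real_ip2 "mat_app scl P" "real_trace P" "real_det P"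
    by (rule quadratic_self_adjoint_mat_app[OF h])
  have form: "0 < (\<Sum>i\<in>UNIV. conjugate (x $ i) * (P *v x) $ i)" if "x \<noteq> 0" for x
    using P that by (simp add: pos_definite_def)
  have nz: "v \<noteq> 0" if "v $ i \<noteq> 0" for v :: "'f^2" and i
    using that by auto
  have p1: "0 < P $ 1 $ 1"
    using form[of "\<chi> i. if i = 1 then 1 else 0", OF nz[of _ 1]]
    by (simp add: sum_2 matrix_vector_mult_def)
  have p2: "0 < P $ 2 $ 2"
    using form[of "\<chi> i. if i = 2 then 1 else 0", OF nz[of _ 2]]
    by (simp add: sum_2 matrix_vector_mult_def)
  have r1: "P $ 1 $ 1 = of_real (real_part (P $ 1 $ 1))"
    using p1 by (simp add: nonneg_imp_of_real)
  have "(of_real (real_trace P) :: 'f) > 0"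
    unfolding of_real_real_trace[OF h] using p1 p2 by (rule add_pos_pos)
  then have tr: "0 < real_trace P" by simp
  \<comment> \<open>at the vector \<open>(- P12, P11)\<close> the form takes the value \<open>P11\<close> times the determinant\<close>
  have "0 < P $ 1 $ 1 * (P $ 1 $ 1 * P $ 2 $ 2 - P $ 1 $ 2 * P $ 2 $ 1)"
    using form[of "\<chi> i. if i = 1 then - P $ 1 $ 2 else P $ 1 $ 1", OF nz[of _ 2]] p1
    by (simp add: sum_2 matrix_vector_mult_def hermitian_sym[OF h] algebra_simps)
  then have "0 < (of_real (real_part (P $ 1 $ 1) * real_det P) :: 'f)"
    unfolding of_real_mult of_real_real_det[OF h] r1[symmetric] .
  moreover have "0 < real_part (P $ 1 $ 1)" using p1 r1 by (metis of_real_pos_iff)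
  ultimately have det: "0 < real_det P"
    by (simp only: of_real_pos_iff zero_less_mult_pos)
  have "real_det P / real_trace P * real_ip2 \<xi> \<xi> \<le> real_ip2 \<xi> (mat_app scl P \<xi>)" for \<xi>
    using Q.ip_self_nonneg[of "mat_app scl P \<xi>"] tr unfolding Q.sqnorm_image
    by (simp add: field_simps)
  with tr det show ?thesis by (metis divide_pos_pos)
qed

lemma real_ip2_mat_app_add:
  "real_ip2 \<xi> (mat_app scl (M + N) \<xi>) = real_ip2 \<xi> (mat_app scl M \<xi>) + real_ip2 \<xi> (mat_app scl N \<xi>)"
  by (simp add: real_ip2_def ip2_def mat_app_def ip_simps algebra_simps flip: real_part_add)

lemma real_ip2_mat_app_scaled_id:
  "real_ip2 \<xi> (mat_app scl (mat (of_real r)) \<xi>) = r * real_ip2 \<xi> \<xi>"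
  by (simp add: real_ip2_def ip2_def mat_app_def mat_def ip_simps distrib_left
      flip: real_part_of_real_mult)

lemma real_ip2_mat_app_uminus:
  "real_ip2 \<xi> (mat_app scl (- M) \<xi>) = - real_ip2 \<xi> (mat_app scl M \<xi>)"
  using real_ip2_mat_app_add[of \<xi> M "- M"] real_ip2_mat_app_scaled_id[of \<xi> 0]
  by (simp add: mat_0)

section \<open>Multipliers, strict negativity and finite gain\<close>

lemma multiplier_iff_strictly_negative:
  assumes M: "hermitian (M :: 'f^2^2)"
  shows "(\<exists>N. hermitian N \<and> M + N \<prec> 0 \<and> (\<forall>x\<in>S. 0 \<le> ip2 ip x (mat_app scl N x))) \<longleftrightarrow>
    (\<exists>\<epsilon>>0. \<forall>x\<in>S. real_ip2 x (mat_app scl M x) \<le> - \<epsilon> * real_ip2 x x)"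
    (is "?L \<longleftrightarrow> ?R")
proof
  assume ?L
  then obtain N where N: "hermitian N" "pos_definite (- (M + N))"
      and S: "\<And>x. x \<in> S \<Longrightarrow> 0 \<le> ip2 ip x (mat_app scl N x)"
    by (auto simp: definite_less_def)
  obtain \<epsilon> where \<epsilon>: "0 < \<epsilon>" "\<And>x. \<epsilon> * real_ip2 x x \<le> real_ip2 x (mat_app scl (- (M + N)) x)"
    using pos_definite_coercive[OF N(2)] by blast
  have "real_ip2 x (mat_app scl M x) \<le> - \<epsilon> * real_ip2 x x" if "x \<in> S" for x
    using \<epsilon>(2)[of x] S[OF that] nonneg_form_iff[OF N(1), of x]
    unfolding real_ip2_mat_app_uminus real_ip2_mat_app_add by linarith
  with \<epsilon>(1) show ?R by blast
next
  assume ?R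
  then obtain \<epsilon> where \<epsilon>: "0 < \<epsilon>"
      and S: "\<And>x. x \<in> S \<Longrightarrow> real_ip2 x (mat_app scl M x) \<le> - \<epsilon> * real_ip2 x x"
    by blast
  define N where "N = - M + mat (of_real (- \<epsilon>))"
  have h: "hermitian N"
    using hermitian_sym[OF M]
    by (auto simp: N_def hermitian_def conj_transpose_def vec_eq_iff conjugate_dist_add
        conjugate_diff conjugate_neg mat_def)
  have "pos_definite (mat (of_real \<epsilon>) :: 'f^2^2)"
    unfolding pos_definite_def
  proof (intro conjI allI impI)
    show "hermitian (mat (of_real \<epsilon>) :: 'f^2^2)"
      by (auto simp: hermitian_def conj_transpose_def vec_eq_iff mat_def)
    fix x :: "'f^2"
    assume "x \<noteq> 0"
    then have x: "x $ 1 \<noteq> 0 \<or> x $ 2 \<noteq> 0"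
      by (simp add: vec_eq_iff forall_2)
    have mul: "conjugate a * (of_real \<epsilon> * a) = of_real (\<epsilon> * (norm a)\<^sup>2)" for a :: 'f
      using mult_conjugate_self[of a] by (simp add: scaleR_conv_of_real mult.left_commute mult.commute)
    have "(\<Sum>i\<in>UNIV. conjugate (x $ i) * (mat (of_real \<epsilon>) *v x) $ i)
        = of_real (\<epsilon> * (norm (x $ 1))\<^sup>2 + \<epsilon> * (norm (x $ 2))\<^sup>2)"
      unfolding of_real_add mul[symmetric] by (simp add: sum_2 matrix_vector_mult_def mat_def)
    moreover have "0 < \<epsilon> * (norm (x $ 1))\<^sup>2 + \<epsilon> * (norm (x $ 2))\<^sup>2"
      using x \<epsilon> by (auto intro: add_pos_nonneg add_nonneg_pos)
    ultimately show "0 < (\<Sum>i\<in>UNIV. conjugate (x $ i) * (mat (of_real \<epsilon>) *v x) $ i)"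
      by (simp only: of_real_pos_iff)
  qed
  moreover have "0 - (M + N) = mat (of_real \<epsilon>)"
    by (simp add: N_def vec_eq_iff mat_def)
  ultimately have "M + N \<prec> 0" by (simp add: definite_less_def)
  moreover have "0 \<le> ip2 ip x (mat_app scl N x)" if "x \<in> S" for x
    using S[OF that] unfolding nonneg_form_iff[OF h]
    unfolding N_def real_ip2_mat_app_add real_ip2_mat_app_scaled_id real_ip2_mat_app_uminus
    by simp
  ultimately show ?L using h by blast
qed

text \<open>
  The vectors \<open>x = (y1, e1)\<close> and \<open>z = (e2, y2)\<close> differ by the inputs, and \<open>(y1, y2)\<close> differs from
  \<open>x\<close> by \<open>(0, u1)\<close>. Hence a bound of the output by the input and a bound of \<open>x\<close> by \<open>z - x\<close> are the
  same up to constants. As \<open>e2\<close> and \<open>y2\<close> are free, \<open>z\<close> runs through all vectors with nonnegative form.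
\<close>

lemma gain_iff_strictly_negative:
  assumes M: "hermitian M"
  shows "(\<exists>\<gamma>>0. \<forall>u1 u2 y1 y2 e1 e2.
        0 \<le> ip2 ip (e2, y2) (mat_app scl M (e2, y2)) \<and>
        e1 = u1 + y2 \<and> e2 = u2 + y1 \<and> (e1, y1) \<in> G \<longrightarrow>
        norm2 ip (y1, y2) \<le> \<gamma> * norm2 ip (u1, u2)) \<longleftrightarrow>
    (\<exists>\<epsilon>>0. \<forall>x\<in>G\<inverse>. real_ip2 x (mat_app scl M x) \<le> - \<epsilon> * real_ip2 x x)"
    (is "?L \<longleftrightarrow> ?R")
proof -
  interpret Q: quadratic_self_adjoint real_scale2 real_ip2 "mat_app scl M" "real_trace M" "real_det M"
    by (rule quadratic_self_adjoint_mat_app[OF M])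
  define n where "n \<xi> = real_ip2 \<xi> \<xi>" for \<xi>
  define q where "q \<xi> = real_ip2 \<xi> (mat_app scl M \<xi>)" for \<xi>
  have n_nonneg: "0 \<le> n \<xi>" for \<xi> unfolding n_def by (rule Q.ip_self_nonneg)
  have n_add: "n (\<xi> + \<zeta>) \<le> 2 * n \<xi> + 2 * n \<zeta>" for \<xi> \<zeta>
    unfolding n_def by (rule Q.sqnorm_add_le)
  have n_minus: "n (- \<xi>) = n \<xi>" for \<xi> unfolding n_def by (simp add: Q.ip_simps)
  have split: "n (a, b) = n (a, 0) + n (0, b)" for a b
  proof -
    have "ip 0 0 = 0" using ip_scale_right[of 0 0 0] by simp
    then show ?thesis by (simp add: n_def real_ip2_def ip2_def real_part_add)
  qed
  have swap: "n (a, b) = n (b, a)" for a b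
    by (simp add: n_def real_ip2_def ip2_def add.commute)
  have n_snd: "n (0, b) \<le> n (b, a)" for a b
    using split[of a b] n_nonneg[of "(a, 0)"] swap[of a b] by linarith
  have gap: "n ((u2 + y1, y2) - (y1, u1 + y2)) = n (u1, u2)" for u1 u2 y1 y2
    using split[of u2 "- u1"] split[of u2 u1] n_minus[of "(0, u1)"] swap[of u1 u2] by simp
  have norm_n: "norm2 ip \<xi> = sqrt (n \<xi>)" for \<xi>
    by (simp add: norm2_eq n_def)
  show ?thesis
  proof
    assume ?R
    then obtain \<epsilon> where \<epsilon>: "0 < \<epsilon>" "\<And>e y. (e, y) \<in> G \<Longrightarrow> q (y, e) \<le> - \<epsilon> * n (y, e)"
      unfolding q_def n_def by blast
    obtain C where C: "0 < C"
        "\<And>x z. q x \<le> - \<epsilon> * n x \<Longrightarrow> 0 \<le> q z \<Longrightarrow> n x \<le> C * n (z - x)"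
      using Q.negative_far_from_nonneg[OF \<epsilon>(1)] unfolding q_def n_def by blast
    have "norm2 ip (y1, y2) \<le> sqrt (2 * C + 2) * norm2 ip (u1, u2)"
      if z: "0 \<le> ip2 ip (u2 + y1, y2) (mat_app scl M (u2 + y1, y2))" and G: "(u1 + y2, y1) \<in> G"
      for u1 u2 y1 y2
    proof -
      have "0 \<le> q (u2 + y1, y2)" using z unfolding q_def nonneg_form_iff[OF M] .
      from C(2)[OF \<epsilon>(2)[OF G] this] have "n (y1, u1 + y2) \<le> C * n (u1, u2)"
        unfolding gap .
      moreover have "n (y1, y2) \<le> 2 * n (y1, u1 + y2) + 2 * n (0, u1)"
        using n_add[of "(y1, u1 + y2)" "- (0, u1)"] unfolding n_minus by simp
      ultimately have "n (y1, y2) \<le> (2 * C + 2) * n (u1, u2)"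
        using n_snd[of u1 u2] by (simp add: algebra_simps)
      then show ?thesis unfolding norm_n real_sqrt_mult[symmetric] by (rule real_sqrt_le_mono)
    qed
    moreover have "0 < sqrt (2 * C + 2)" using C(1) by simp
    ultimately show ?L by blast
  next
    assume ?L
    then obtain \<gamma> where \<gamma>: "0 < \<gamma>" and gain: "\<And>u1 u2 y1 y2.
        0 \<le> ip2 ip (u2 + y1, y2) (mat_app scl M (u2 + y1, y2)) \<Longrightarrow> (u1 + y2, y1) \<in> G \<Longrightarrow>
        norm2 ip (y1, y2) \<le> \<gamma> * norm2 ip (u1, u2)"
      by blast
    define D where "D = 2 * \<gamma>\<^sup>2 + 2"
    have D: "0 < D" by (simp add: D_def add_nonneg_pos)
    have far: "n (y, e) \<le> D * n (z - (y, e))" if G: "(e, y) \<in> G" and z: "0 \<le> q z" for e y z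
    proof -
      obtain e2 y2 where z_eq: "z = (e2, y2)" by (cases z)
      define u1 u2 where "u1 = e - y2" and "u2 = e2 - y"
      have eqs: "e = u1 + y2" "e2 = u2 + y" by (simp_all add: u1_def u2_def)
      have "sqrt (n (y, y2)) \<le> \<gamma> * sqrt (n (u1, u2))"
        unfolding norm_n[symmetric]
        by (rule gain) (use G z in \<open>simp_all add: nonneg_form_iff[OF M] z_eq eqs q_def\<close>)
      then have "(sqrt (n (y, y2)))\<^sup>2 \<le> (\<gamma> * sqrt (n (u1, u2)))\<^sup>2"
        by (rule power_mono) (simp add: n_nonneg)
      then have "n (y, y2) \<le> \<gamma>\<^sup>2 * n (u1, u2)"
        by (simp add: power_mult_distrib n_nonneg)
      moreover have "n (y, e) \<le> 2 * n (y, y2) + 2 * n (0, u1)"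
        using n_add[of "(y, y2)" "(0, u1)"] by (simp add: eqs add.commute)
      ultimately have "n (y, e) \<le> D * n (u1, u2)"
        using n_snd[of u1 u2] by (simp add: D_def algebra_simps)
      then show ?thesis using gap[of u2 y y2 u1] by (simp add: z_eq eqs)
    qed
    \<comment> \<open>by \<open>far\<close>, only vectors \<open>x\<close> of seminorm zero have a point with nonnegative form
        within this relative distance\<close>
    have "0 < 1 / (2 * D)" using D by simp
    then obtain \<epsilon> where \<epsilon>: "0 < \<epsilon>" "\<And>x. q x \<le> - \<epsilon> * n x \<or>
        (\<exists>z. 0 \<le> q z \<and> n (z - x) \<le> 1 / (2 * D) * n x)"
      using Q.nonneg_close_or_negative unfolding q_def n_def by meson
    have "q (y, e) \<le> - \<epsilon> * n (y, e)" if G: "(e, y) \<in> G" for e y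
      using \<epsilon>(2)[of "(y, e)"]
    proof
      assume "\<exists>z. 0 \<le> q z \<and> n (z - (y, e)) \<le> 1 / (2 * D) * n (y, e)"
      then obtain z where "0 \<le> q z" and z: "n (z - (y, e)) \<le> 1 / (2 * D) * n (y, e)" by blast
      have "n (y, e) \<le> D * n (z - (y, e))" by (rule far) fact+
      also have "\<dots> \<le> D * (1 / (2 * D) * n (y, e))"
        using z D by (intro mult_left_mono) auto
      finally have "n (y, e) = 0" using D n_nonneg[of "(y, e)"] by simp
      moreover obtain K where "\<bar>q (y, e)\<bar> \<le> K * n (y, e)"
        using Q.form_bounded unfolding q_def n_def by blast
      ultimately show ?thesis by simp
    qed
    with \<epsilon>(1) show ?R unfolding q_def n_def by blast
  qed
qed

end

theorem theorem1:
  fixes scl :: "'f::real_or_complex \<Rightarrow> 'v::ab_group_add \<Rightarrow> 'v"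
    and ip :: "'v \<Rightarrow> 'v \<Rightarrow> 'f"
    and M :: "'f^2^2"
    and G :: "('v \<times> 'v) set"
    and C\<^sub>\<Phi> :: "('v \<times> 'v) set set"
  assumes "semi_inner_product_space scl ip"
    and "hermitian M"
  defines "stmt_i \<equiv>
      \<exists>N :: 'f^2^2. hermitian N \<and> M + N \<prec> 0 \<and>
        (\<forall>(\<xi>, \<zeta>) \<in> G. 0 \<le> ip2 ip (\<zeta>, \<xi>) (mat_app scl N (\<zeta>, \<xi>)))"
    and "stmt_ii \<equiv>
      \<exists>\<gamma> > 0. \<forall>u1 u2 y1 y2 e1 e2.
        0 \<le> ip2 ip (e2, y2) (mat_app scl M (e2, y2)) \<and>
        e1 = u1 + y2 \<and> e2 = u2 + y1 \<and> (e1, y1) \<in> G \<longrightarrow>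
        norm2 ip (y1, y2) \<le> \<gamma> * norm2 ip (u1, u2)"
    and "stmt_iii \<equiv>
      \<exists>\<gamma> > 0. \<forall>\<Phi> \<in> C\<^sub>\<Phi>.
        (\<forall>(\<xi>, \<zeta>) \<in> \<Phi>. 0 \<le> ip2 ip (\<xi>, \<zeta>) (mat_app scl M (\<xi>, \<zeta>))) \<longrightarrow>
        (\<forall>(u, y) \<in> closed_loop G \<Phi>. norm2 ip y \<le> \<gamma> * norm2 ip u)"
  shows "(stmt_i \<longleftrightarrow> stmt_ii) \<and> (stmt_ii \<longrightarrow> stmt_iii)"
proof -
  interpret semi_inner_product_space scl ip by fact
  have "(\<forall>(\<xi>, \<zeta>)\<in>G. 0 \<le> ip2 ip (\<zeta>, \<xi>) (mat_app scl N (\<zeta>, \<xi>))) \<longleftrightarrow>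
      (\<forall>x\<in>G\<inverse>. 0 \<le> ip2 ip x (mat_app scl N x))" for N
    by auto
  then have "stmt_i \<longleftrightarrow> (\<exists>N. hermitian N \<and> M + N \<prec> 0 \<and> (\<forall>x\<in>G\<inverse>. 0 \<le> ip2 ip x (mat_app scl N x)))"
    unfolding stmt_i_def by simp
  then have "stmt_i \<longleftrightarrow> stmt_ii"
    unfolding stmt_ii_def multiplier_iff_strictly_negative[OF \<open>hermitian M\<close>]
      gain_iff_strictly_negative[OF \<open>hermitian M\<close>] .
  moreover have "stmt_iii" if stmt_ii
    using that unfolding stmt_ii_def stmt_iii_def closed_loop_def by fastforce
  ultimately show ?thesis by blast
qed

end
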